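(* A left stabilization of virtual type is a consequence of a VM2-move and some VM0- and VM1-moves: for every $m\ge1$ and every virtual braid $b\in VB_m$, the virtual braid $\iota_1^0(b)\tau_1\in VB_{m+1}$ is obtained from $b$ by a finite sequence consisting of one VM2-move and some VM0- and VM1-moves.
   Context: The virtual braid group $VB_m$ ($m\ge1$) is the group with generators $\sigma_i,\tau_i$ ($1\le i\le m-1$) and relations: $\sigma_i\sigma_j=\sigma_j\sigma_i$ for $|i-j|>1$; $\sigma_i\sigma_{i+1}\sigma_i=\sigma_{i+1}\sigma_i\sigma_{i+1}$; $\tau_i^2=1$; $\tau_i\tau_j=\tau_j\tau_i$ for $|i-j|>1$; $\tau_i\tau_{i+1}\tau_i=\tau_{i+1}\tau_i\tau_{i+1}$; $\sigma_i\tau_j=\tau_j\sigma_i$ for $|i-j|>1$; $\sigma_i\tau_{i+1}\tau_i=\tau_{i+1}\tau_i\sigma_{i+1}$. Its elements are called virtual braids of degree $m$. The homomorphism $\iota_s^t:VB_m\to VB_{m+s+t}$ is given by $\sigma_i\mapsto\sigma_{i+s}$, $\tau_i\mapsto\tau_{i+s}$ (adding $s$ trivial strands to the left and $t$ to the right). A left stabilization of virtual type is the replacement of $b\in VB_m$ by $\iota_1^0(b)\tau_1\in VB_{m+1}$. Moves. (VM0) a braid move: applying a defining relation of the virtual braid group (trivial on elements of $VB_m$; it matters only for words/diagrams). (VM1) a conjugation: $b_1\mapsto b_2^{-1}b_1b_2$ with $b_1,b_2\in VB_m$. (VM2) a right stabilization of positive, negative or virtual type, replacing $b\in VB_m$ by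 $\iota_0^1(b)\sigma_m$, $\iota_0^1(b)\sigma_m^{-1}$ or $\iota_0^1(b)\tau_m\in VB_{m+1}$, and its inverse operation. *)

theory Defs
  imports "HOL-Algebra.Group"
begin

section \<open>Groups given by generators and relations\<close>

datatype 'a letter = Gen 'a | GenInv 'a

fun flip :: "'a letter \<Rightarrow> 'a letter" where
  "flip (Gen a) = GenInv a"
| "flip (GenInv a) = Gen a"

definition words :: "'a set \<Rightarrow> 'a letter list set" where
  "words S = lists (Gen ` S \<union> GenInv ` S)"

text \<open>One application, inside a word, of a relation of \<open>R\<close> or of a cancellation
  \<open>x x\<^sup>-\<^sup>1 = 1\<close> or \<open>x\<^sup>-\<^sup>1 x = 1\<close>, in either direction.\<close>

definition elementary ::
  "'a set \<Rightarrow> ('a letter list \<times> 'a letter list) set \<Rightarrow> ('a letter list \<times> 'a letter list) set" where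
  "elementary S R =
     (let R' = R \<union> {([x, flip x], []) | x. x \<in> Gen ` S \<union> GenInv ` S}
      in {(u @ l @ v, u @ r @ v) | u v l r.
            u \<in> words S \<and> v \<in> words S \<and> (l, r) \<in> R' \<union> R'\<inverse>})"

definition word_rel ::
  "'a set \<Rightarrow> ('a letter list \<times> 'a letter list) set \<Rightarrow> ('a letter list \<times> 'a letter list) set" where
  "word_rel S R = (elementary S R)\<^sup>* \<inter> words S \<times> words S"

definition presented_group ::
  "'a set \<Rightarrow> ('a letter list \<times> 'a letter list) set \<Rightarrow> 'a letter list set monoid" where
  "presented_group S R =
     \<lparr>carrier = words S // word_rel S R,
      mult = (\<lambda>X Y. \<Union>x\<in>X. \<Union>y\<in>Y. word_rel S R `` {x @ y}),
      one = word_rel S R `` {[]}\<rparr>"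


section \<open>Virtual braid groups\<close>

datatype vb_gen = Sigma nat | Tau nat

type_synonym vb_word = "vb_gen letter list"

type_synonym vbraid = "vb_word set"

abbreviation gs :: "nat \<Rightarrow> vb_gen letter" where "gs i \<equiv> Gen (Sigma i)"
abbreviation gt :: "nat \<Rightarrow> vb_gen letter" where "gt i \<equiv> Gen (Tau i)"

definition vb_gens :: "nat \<Rightarrow> vb_gen set" where
  "vb_gens m = Sigma ` {1..<m} \<union> Tau ` {1..<m}"

inductive_set vb_rels :: "nat \<Rightarrow> (vb_word \<times> vb_word) set" for m :: nat where
  sigma_comm: "\<lbrakk>i \<in> {1..<m}; j \<in> {1..<m}; \<bar>int i - int j\<bar> > 1\<rbrakk>
      \<Longrightarrow> ([gs i, gs j], [gs j, gs i]) \<in> vb_rels m"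
| sigma_braid: "\<lbrakk>i \<in> {1..<m}; i + 1 \<in> {1..<m}\<rbrakk>
      \<Longrightarrow> ([gs i, gs (i + 1), gs i], [gs (i + 1), gs i, gs (i + 1)]) \<in> vb_rels m"
| tau_square: "i \<in> {1..<m} \<Longrightarrow> ([gt i, gt i], []) \<in> vb_rels m"
| tau_comm: "\<lbrakk>i \<in> {1..<m}; j \<in> {1..<m}; \<bar>int i - int j\<bar> > 1\<rbrakk>
      \<Longrightarrow> ([gt i, gt j], [gt j, gt i]) \<in> vb_rels m"
| tau_braid: "\<lbrakk>i \<in> {1..<m}; i + 1 \<in> {1..<m}\<rbrakk>
      \<Longrightarrow> ([gt i, gt (i + 1), gt i], [gt (i + 1), gt i, gt (i + 1)]) \<in> vb_rels m"
| mixed_comm: "\<lbrakk>i \<in> {1..<m}; j \<in> {1..<m}; \<bar>int i - int j\<bar> > 1\<rbrakk>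
      \<Longrightarrow> ([gs i, gt j], [gt j, gs i]) \<in> vb_rels m"
| mixed_braid: "\<lbrakk>i \<in> {1..<m}; i + 1 \<in> {1..<m}\<rbrakk>
      \<Longrightarrow> ([gs i, gt (i + 1), gt i], [gt (i + 1), gt i, gs (i + 1)]) \<in> vb_rels m"

abbreviation vb_rel :: "nat \<Rightarrow> (vb_word \<times> vb_word) set" where
  "vb_rel m \<equiv> word_rel (vb_gens m) (vb_rels m)"

definition VB :: "nat \<Rightarrow> vbraid monoid" where
  "VB m = presented_group (vb_gens m) (vb_rels m)"

definition sigma :: "nat \<Rightarrow> nat \<Rightarrow> vbraid" where
  "sigma m i = vb_rel m `` {[gs i]}"

definition tau :: "nat \<Rightarrow> nat \<Rightarrow> vbraid" where
  "tau m i = vb_rel m `` {[gt i]}"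

fun shift_gen :: "nat \<Rightarrow> vb_gen \<Rightarrow> vb_gen" where
  "shift_gen k (Sigma i) = Sigma (i + k)"
| "shift_gen k (Tau i) = Tau (i + k)"

definition shift :: "nat \<Rightarrow> vb_word \<Rightarrow> vb_word" where
  "shift k w = map (map_letter (shift_gen k)) w"

text \<open>\<open>iota p q m\<close> is the map \<open>VB m \<rightarrow> VB (m + p + q)\<close> adding \<open>p\<close> trivial strands to the left
  and \<open>q\<close> to the right.\<close>

definition iota :: "nat \<Rightarrow> nat \<Rightarrow> nat \<Rightarrow> vbraid \<Rightarrow> vbraid" where
  "iota p q m b = (\<Union>w\<in>b. vb_rel (m + p + q) `` {shift p w})"


section \<open>Moves\<close>

text \<open>The moves are relations between virtual braids of possibly different degrees, so a virtual
  braid is paired with its degree.\<close>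

text \<open>A braid move changes a representing word only, so that \<open>VM0\<close> is contained in the identity
  (lemma \<open>VM0_trivial\<close> below).\<close>

definition VM0 :: "((nat \<times> vbraid) \<times> (nat \<times> vbraid)) set" where
  "VM0 = {((m, b), (m, b')) | m b b'.
      m \<ge> 1 \<and> b \<in> carrier (VB m) \<and> b' \<in> carrier (VB m) \<and>
      (\<exists>w\<in>b. \<exists>w'\<in>b'. (w, w') \<in> elementary (vb_gens m) (vb_rels m))}"

definition VM1 :: "((nat \<times> vbraid) \<times> (nat \<times> vbraid)) set" where
  "VM1 = {((m, b1), (m, inv\<^bsub>VB m\<^esub> b2 \<otimes>\<^bsub>VB m\<^esub> b1 \<otimes>\<^bsub>VB m\<^esub> b2)) | m b1 b2.
      m \<ge> 1 \<and> b1 \<in> carrier (VB m) \<and> b2 \<in> carrier (VB m)}"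

definition right_stabilization :: "((nat \<times> vbraid) \<times> (nat \<times> vbraid)) set" where
  "right_stabilization = {((m, b), (m + 1, iota 0 1 m b \<otimes>\<^bsub>VB (m + 1)\<^esub> g)) | m b g.
      m \<ge> 1 \<and> b \<in> carrier (VB m) \<and>
      g \<in> {sigma (m + 1) m, inv\<^bsub>VB (m + 1)\<^esub> sigma (m + 1) m, tau (m + 1) m}}"

definition VM2 :: "((nat \<times> vbraid) \<times> (nat \<times> vbraid)) set" where
  "VM2 = right_stabilization \<union> right_stabilization\<inverse>"

definition left_virtual_stabilization :: "nat \<Rightarrow> vbraid \<Rightarrow> vbraid" where
  "left_virtual_stabilization m b = iota 1 0 m b \<otimes>\<^bsub>VB (m + 1)\<^esub> tau (m + 1) 1"


section \<open>Well-definedness\<close>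

lemma words_append: "u @ v \<in> words S \<longleftrightarrow> u \<in> words S \<and> v \<in> words S"
  by (auto simp: words_def)

lemma words_Nil: "[] \<in> words S"
  by (simp add: words_def)

lemma sym_elementary: "sym (elementary S R)"
  unfolding elementary_def Let_def sym_def by blast

lemma elementary_context:
  assumes "(x, y) \<in> elementary S R" "u \<in> words S" "v \<in> words S"
  shows "(u @ x @ v, u @ y @ v) \<in> elementary S R"
proof -
  from assms(1) obtain u' v' l r where *: "x = u' @ l @ v'" "y = u' @ r @ v'"
      "u' \<in> words S" "v' \<in> words S"
      "(l, r) \<in> (R \<union> {([x, flip x], []) | x. x \<in> Gen ` S \<union> GenInv ` S})
         \<union> (R \<union> {([x, flip x], []) | x. x \<in> Gen ` S \<union> GenInv ` S})\<inverse>"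
    unfolding elementary_def Let_def by blast
  have "u @ x @ v = (u @ u') @ l @ (v' @ v)" "u @ y @ v = (u @ u') @ r @ (v' @ v)"
    using * by simp_all
  moreover have "u @ u' \<in> words S" "v' @ v \<in> words S"
    using * assms by (simp_all add: words_append)
  ultimately show ?thesis
    using *(5) unfolding elementary_def Let_def by blast
qed

lemma elementary_rtrancl_context:
  assumes "(x, y) \<in> (elementary S R)\<^sup>*" "u \<in> words S" "v \<in> words S"
  shows "(u @ x @ v, u @ y @ v) \<in> (elementary S R)\<^sup>*"
  using assms(1)
proof (induction rule: rtrancl_induct)
  case (step y z)
  from elementary_context[OF step.hyps(2) assms(2,3)] step.IH show ?case
    by (rule rtrancl_into_rtrancl[rotated])
qed simp

lemma equiv_word_rel: "equiv (words S) (word_rel S R)"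
proof (rule equivI)
  show "word_rel S R \<subseteq> words S \<times> words S" "refl_on (words S) (word_rel S R)"
    by (auto simp: word_rel_def refl_on_def)
  show "sym (word_rel S R)"
    using sym_rtrancl[OF sym_elementary] unfolding word_rel_def sym_def by blast
  show "trans (word_rel S R)"
    unfolding word_rel_def trans_def by (blast intro: rtrancl_trans)
qed

lemma word_rel_append:
  assumes "(x, x') \<in> word_rel S R" "(y, y') \<in> word_rel S R"
  shows "(x @ y, x' @ y') \<in> word_rel S R"
proof -
  have "(x @ y, x' @ y) \<in> (elementary S R)\<^sup>*"
    using elementary_rtrancl_context[of x x' S R "[]" y] assms
    by (auto simp: word_rel_def words_Nil)
  moreover have "(x' @ y, x' @ y') \<in> (elementary S R)\<^sup>*"
    using elementary_rtrancl_context[of y y' S R x' "[]"] assms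
    by (auto simp: word_rel_def words_Nil)
  ultimately show ?thesis
    using assms by (auto simp: word_rel_def words_append)
qed

lemma word_rel_cancel:
  assumes "w \<in> words S"
  shows "(w @ rev (map flip w), []) \<in> word_rel S R \<and> rev (map flip w) \<in> words S"
  using assms
proof (induction w)
  case Nil
  then show ?case by (auto simp: word_rel_def words_Nil)
next
  case (Cons a w)
  let ?w' = "rev (map flip w)"
  from Cons.prems have a: "a \<in> Gen ` S \<union> GenInv ` S" and w: "w \<in> words S"
    by (auto simp: words_def)
  from a have fa: "[flip a] \<in> words S" and a1: "[a] \<in> words S" by (auto simp: words_def)
  from Cons.IH[OF w] have IH: "(w @ ?w', []) \<in> word_rel S R" "?w' \<in> words S" by auto
  have "([a] @ (w @ ?w') @ [flip a], [a] @ [] @ [flip a]) \<in> (elementary S R)\<^sup>*"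
    using IH a1 fa by (intro elementary_rtrancl_context) (auto simp: word_rel_def)
  moreover have "([] @ [a, flip a] @ [], [] @ [] @ []) \<in> elementary S R"
    using a words_Nil[of S] unfolding elementary_def Let_def by blast
  ultimately have "((a # w) @ rev (map flip (a # w)), []) \<in> (elementary S R)\<^sup>*"
    by simp
  moreover have "rev (map flip (a # w)) \<in> words S"
    using IH fa by (simp add: words_append)
  ultimately show ?case
    using Cons.prems words_append[of "a # w" "rev (map flip (a # w))" S] words_Nil[of S]
    unfolding word_rel_def by blast
qed

lemma presented_group_mult:
  assumes "x \<in> words S" "y \<in> words S"
  shows "word_rel S R `` {x} \<otimes>\<^bsub>presented_group S R\<^esub> word_rel S R `` {y} = word_rel S R `` {x @ y}"
proof -
  have "congruent2 (word_rel S R) (word_rel S R) (\<lambda>x y. word_rel S R `` {x @ y})"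
    unfolding congruent2_def using equiv_class_eq[OF equiv_word_rel word_rel_append] by fast
  from UN_equiv_class2[OF equiv_word_rel equiv_word_rel this assms] show ?thesis
    by (simp add: presented_group_def)
qed

lemma flip_flip [simp]: "flip (flip x) = x"
  by (cases x) auto

lemma group_presented_group: "group (presented_group S R)"
proof (rule groupI)
  let ?G = "presented_group S R" and ?c = "\<lambda>w. word_rel S R `` {w}"
  have car: "carrier ?G = ?c ` words S"
    by (auto simp: presented_group_def quotient_def)
  have one: "\<one>\<^bsub>?G\<^esub> = ?c []"
    by (simp add: presented_group_def)
  show "\<one>\<^bsub>?G\<^esub> \<in> carrier ?G"
    unfolding car one by (blast intro: words_Nil)
  show "x \<otimes>\<^bsub>?G\<^esub> y \<in> carrier ?G" if "x \<in> carrier ?G" "y \<in> carrier ?G" for x y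
    using that unfolding car by (auto simp: presented_group_mult words_append)
  show "x \<otimes>\<^bsub>?G\<^esub> y \<otimes>\<^bsub>?G\<^esub> z = x \<otimes>\<^bsub>?G\<^esub> (y \<otimes>\<^bsub>?G\<^esub> z)"
    if "x \<in> carrier ?G" "y \<in> carrier ?G" "z \<in> carrier ?G" for x y z
    using that unfolding car by (auto simp: presented_group_mult words_append)
  show "\<one>\<^bsub>?G\<^esub> \<otimes>\<^bsub>?G\<^esub> x = x" if "x \<in> carrier ?G" for x
    using that unfolding car one by (auto simp: presented_group_mult words_Nil)
  show "\<exists>y\<in>carrier ?G. y \<otimes>\<^bsub>?G\<^esub> x = \<one>\<^bsub>?G\<^esub>" if x: "x \<in> carrier ?G" for x
  proof -
    from x obtain w where w: "w \<in> words S" "x = ?c w" unfolding car by auto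
    let ?w = "rev (map flip w)"
    have w': "?w \<in> words S" using word_rel_cancel[OF w(1)] by blast
    have "(?w @ rev (map flip ?w), []) \<in> word_rel S R"
      using word_rel_cancel[OF w'] by blast
    moreover have "rev (map flip ?w) = w"
      by (simp add: rev_map comp_def)
    ultimately have "?c (?w @ w) = ?c []"
      using equiv_class_eq[OF equiv_word_rel] by metis
    then have "?c ?w \<otimes>\<^bsub>?G\<^esub> x = \<one>\<^bsub>?G\<^esub>"
      using w w' by (simp add: presented_group_mult one)
    then show ?thesis using w' unfolding car by blast
  qed
qed

lemma group_VB: "group (VB m)"
  unfolding VB_def by (rule group_presented_group)

lemma VM0_trivial: "VM0 \<subseteq> Id"
proof -
  have "b = b'" if b: "b \<in> carrier (VB m)" "b' \<in> carrier (VB m)"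
    and w: "w \<in> b" "w' \<in> b'" "(w, w') \<in> elementary (vb_gens m) (vb_rels m)" for m b b' w w'
  proof -
    have q: "b \<in> words (vb_gens m) // vb_rel m" "b' \<in> words (vb_gens m) // vb_rel m"
      using b by (auto simp: VB_def presented_group_def)
    have "w \<in> words (vb_gens m)" "w' \<in> words (vb_gens m)"
      using in_quotient_imp_subset[OF equiv_word_rel q(1)]
        in_quotient_imp_subset[OF equiv_word_rel q(2)] w by auto
    then have "(w, w') \<in> vb_rel m" using w by (auto simp: word_rel_def)
    from quotient_eqI[OF equiv_word_rel q w(1,2) this] show ?thesis .
  qed
  then show ?thesis unfolding VM0_def by blast
qed

lemma vb_gens_iff: "Sigma i \<in> vb_gens m \<longleftrightarrow> i \<in> {1..<m}" "Tau i \<in> vb_gens m \<longleftrightarrow> i \<in> {1..<m}"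
  by (auto simp: vb_gens_def)

lemma shift_letter_words:
  assumes "x \<in> Gen ` vb_gens m \<union> GenInv ` vb_gens m"
  shows "map_letter (shift_gen p) x \<in> Gen ` vb_gens (m + p + q) \<union> GenInv ` vb_gens (m + p + q)"
  using assms by (auto simp: vb_gens_def image_iff)

lemma shift_words: "w \<in> words (vb_gens m) \<Longrightarrow> shift p w \<in> words (vb_gens (m + p + q))"
  using shift_letter_words unfolding shift_def words_def by fastforce

lemma shift_rels:
  assumes "(l, r) \<in> vb_rels m"
  shows "(shift p l, shift p r) \<in> vb_rels (m + p + q)"
  using assms
proof cases
  case (sigma_comm i j)
  then show ?thesis using vb_rels.sigma_comm[of "i + p" "m + p + q" "j + p"] by (simp add: shift_def)
next
  case (sigma_braid i)
  then show ?thesis using vb_rels.sigma_braid[of "i + p" "m + p + q"] by (simp add: shift_def)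
next
  case (tau_square i)
  then show ?thesis using vb_rels.tau_square[of "i + p" "m + p + q"] by (simp add: shift_def)
next
  case (tau_comm i j)
  then show ?thesis using vb_rels.tau_comm[of "i + p" "m + p + q" "j + p"] by (simp add: shift_def)
next
  case (tau_braid i)
  then show ?thesis using vb_rels.tau_braid[of "i + p" "m + p + q"] by (simp add: shift_def)
next
  case (mixed_comm i j)
  then show ?thesis using vb_rels.mixed_comm[of "i + p" "m + p + q" "j + p"] by (simp add: shift_def)
next
  case (mixed_braid i)
  then show ?thesis using vb_rels.mixed_braid[of "i + p" "m + p + q"] by (simp add: shift_def)
qed

lemma shift_elementary:
  assumes "(x, y) \<in> elementary (vb_gens m) (vb_rels m)"
  shows "(shift p x, shift p y) \<in> elementary (vb_gens (m + p + q)) (vb_rels (m + p + q))"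
proof -
  define C where "C = (\<lambda>m. {([x, flip x], [] :: vb_word) | x. x \<in> Gen ` vb_gens m \<union> GenInv ` vb_gens m})"
  have flip: "map_letter f (flip x) = flip (map_letter f x)" for f :: "vb_gen \<Rightarrow> vb_gen" and x
    by (cases x) auto
  have C: "(shift p l, shift p r) \<in> C (m + p + q)" if "(l, r) \<in> C m" for l r
    using that shift_letter_words unfolding C_def shift_def by (fastforce simp: flip)
  from assms obtain u v l r where *: "x = u @ l @ v" "y = u @ r @ v"
      "u \<in> words (vb_gens m)" "v \<in> words (vb_gens m)"
      "(l, r) \<in> (vb_rels m \<union> C m) \<union> (vb_rels m \<union> C m)\<inverse>"
    unfolding elementary_def Let_def C_def by blast
  have "shift p x = shift p u @ shift p l @ shift p v" "shift p y = shift p u @ shift p r @ shift p v"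
    using * by (simp_all add: shift_def)
  moreover have "(shift p l, shift p r) \<in>
      (vb_rels (m + p + q) \<union> C (m + p + q)) \<union> (vb_rels (m + p + q) \<union> C (m + p + q))\<inverse>"
    using *(5) shift_rels C by blast
  ultimately show ?thesis
    using shift_words[OF *(3), of p q] shift_words[OF *(4), of p q]
    unfolding elementary_def Let_def C_def by blast
qed

lemma shift_word_rel:
  assumes "(x, y) \<in> vb_rel m"
  shows "(shift p x, shift p y) \<in> vb_rel (m + p + q)"
proof -
  from assms have "(x, y) \<in> (elementary (vb_gens m) (vb_rels m))\<^sup>*"
    by (simp add: word_rel_def)
  then have "(shift p x, shift p y) \<in> (elementary (vb_gens (m + p + q)) (vb_rels (m + p + q)))\<^sup>*"
    by induction (auto intro: rtrancl_into_rtrancl shift_elementary)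
  then show ?thesis using assms shift_words by (auto simp: word_rel_def)
qed

lemma iota_class:
  assumes "w \<in> words (vb_gens m)"
  shows "iota p q m (vb_rel m `` {w}) = vb_rel (m + p + q) `` {shift p w}"
proof -
  have "congruent (vb_rel m) (\<lambda>w. vb_rel (m + p + q) `` {shift p w})"
    unfolding congruent_def using equiv_class_eq[OF equiv_word_rel shift_word_rel] by fast
  from UN_equiv_class[OF equiv_word_rel this assms] show ?thesis
    by (simp add: iota_def)
qed

lemma iota_hom: "iota p q m \<in> hom (VB m) (VB (m + p + q))"
proof (rule homI)
  have car: "carrier (VB m) = (\<lambda>w. vb_rel m `` {w}) ` words (vb_gens m)" for m
    by (auto simp: VB_def presented_group_def quotient_def)
  show "iota p q m x \<in> carrier (VB (m + p + q))" if "x \<in> carrier (VB m)" for x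
    using that shift_words unfolding car by (fastforce simp: iota_class)
  show "iota p q m (x \<otimes>\<^bsub>VB m\<^esub> y) = iota p q m x \<otimes>\<^bsub>VB (m + p + q)\<^esub> iota p q m y"
    if xy: "x \<in> carrier (VB m)" "y \<in> carrier (VB m)" for x y
  proof -
    from xy obtain v w where *: "x = vb_rel m `` {v}" "y = vb_rel m `` {w}"
        "v \<in> words (vb_gens m)" "w \<in> words (vb_gens m)"
      unfolding car by auto
    have "shift p (v @ w) = shift p v @ shift p w" by (simp add: shift_def)
    then show ?thesis
      using * by (simp add: VB_def presented_group_mult iota_class words_append shift_words)
  qed
qed

lemma iota_sigma: "i \<in> {1..<m} \<Longrightarrow> iota p q m (sigma m i) = sigma (m + p + q) (i + p)"
  unfolding sigma_def by (subst iota_class) (auto simp: words_def shift_def vb_gens_iff)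

lemma iota_tau: "i \<in> {1..<m} \<Longrightarrow> iota p q m (tau m i) = tau (m + p + q) (i + p)"
  unfolding tau_def by (subst iota_class) (auto simp: words_def shift_def vb_gens_iff)

end

theory Submission
  imports Defs
begin

text \<open>
  Write \<open>c\<^sub>k = \<tau>\<^sub>k \<dots> \<tau>\<^sub>1\<close>. In \<open>VB\<^sub>m\<^sub>+\<^sub>1\<close> the element \<open>c\<^sub>m\<close> moves the extra strand from the right to the
  left: \<open>\<iota>\<^sub>0\<^sup>1(b) c\<^sub>m = c\<^sub>m \<iota>\<^sub>1\<^sup>0(b)\<close> for every \<open>b \<in> VB\<^sub>m\<close>. Moreover
  \<open>c\<^sub>m\<^sub>-\<^sub>1 c\<^sub>m \<tau>\<^sub>1 = \<tau>\<^sub>m c\<^sub>m\<^sub>-\<^sub>1 c\<^sub>m\<close>. Hence, if \<open>b\<close> is first conjugated to \<open>c\<^sub>m\<^sub>-\<^sub>1 b c\<^sub>m\<^sub>-\<^sub>1\<^sup>-\<^sup>1\<close>, then stabilized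
  on the right by \<open>\<tau>\<^sub>m\<close>, and the result is conjugated by \<open>c\<^sub>m\<^sub>-\<^sub>1 c\<^sub>m\<close>, one arrives at \<open>\<iota>\<^sub>1\<^sup>0(b) \<tau>\<^sub>1\<close>.
\<close>

section \<open>From words to elements of \<open>VB n\<close>\<close>

lemma carrier_VB: "carrier (VB n) = (\<lambda>w. vb_rel n `` {w}) ` words (vb_gens n)"
  by (auto simp: VB_def presented_group_def quotient_def)

lemma class_append:
  "x \<in> words (vb_gens n) \<Longrightarrow> y \<in> words (vb_gens n) \<Longrightarrow>
    vb_rel n `` {x @ y} = vb_rel n `` {x} \<otimes>\<^bsub>VB n\<^esub> vb_rel n `` {y}"
  by (simp add: VB_def presented_group_mult)

lemma class_Cons:
  "[a] \<in> words (vb_gens n) \<Longrightarrow> x \<in> words (vb_gens n) \<Longrightarrow>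
    vb_rel n `` {a # x} = vb_rel n `` {[a]} \<otimes>\<^bsub>VB n\<^esub> vb_rel n `` {x}"
  using class_append[of "[a]" n x] by simp

lemma class_Nil: "vb_rel n `` {[]} = \<one>\<^bsub>VB n\<^esub>"
  by (simp add: VB_def presented_group_def)

text \<open>Left inverses in a group are unique, so it is enough that the word
  \<open>[GenInv a, Gen a]\<close> cancels. This handles inverse letters in
  \<open>VB_induct\<close>.\<close>

lemma class_GenInv:
  assumes "a \<in> vb_gens n"
  shows "vb_rel n `` {[GenInv a]} = inv\<^bsub>VB n\<^esub> (vb_rel n `` {[Gen a]})"
proof -
  interpret group "VB n" by (rule group_VB)
  have w: "[Gen a] \<in> words (vb_gens n)" "[GenInv a] \<in> words (vb_gens n)"
    using assms by (auto simp: words_def)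
  have "([GenInv a, Gen a], []) \<in> vb_rel n"
    using word_rel_cancel[OF w(2)] by simp
  then have "vb_rel n `` {[GenInv a, Gen a]} = vb_rel n `` {[]}"
    by (rule equiv_class_eq[OF equiv_word_rel])
  then have "vb_rel n `` {[GenInv a]} \<otimes>\<^bsub>VB n\<^esub> vb_rel n `` {[Gen a]} = \<one>\<^bsub>VB n\<^esub>"
    using class_append[OF w(2,1)] by (simp add: class_Nil)
  then show ?thesis
    using w by (intro inv_equality[symmetric]) (auto simp: carrier_VB)
qed

lemma class_rel:
  assumes "(l, r) \<in> vb_rels n" "l \<in> words (vb_gens n)" "r \<in> words (vb_gens n)"
  shows "vb_rel n `` {l} = vb_rel n `` {r}"
proof -
  have "([] @ l @ [], [] @ r @ []) \<in> elementary (vb_gens n) (vb_rels n)"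
    using assms(1) words_Nil unfolding elementary_def Let_def by blast
  then have "(l, r) \<in> vb_rel n"
    using assms by (auto simp: word_rel_def)
  then show ?thesis
    by (rule equiv_class_eq[OF equiv_word_rel])
qed

section \<open>Generators and defining relations as identities in the group\<close>

lemma gen_words:
  "i \<in> {1..<n} \<Longrightarrow> [gs i] \<in> words (vb_gens n)" "i \<in> {1..<n} \<Longrightarrow> [gt i] \<in> words (vb_gens n)"
  by (auto simp: words_def vb_gens_iff)

lemma sigma_closed: "i \<in> {1..<n} \<Longrightarrow> sigma n i \<in> carrier (VB n)"
  unfolding carrier_VB sigma_def using gen_words by blast

lemma tau_closed: "i \<in> {1..<n} \<Longrightarrow> tau n i \<in> carrier (VB n)"
  unfolding carrier_VB tau_def using gen_words by blast

text \<open>These turn the class of a word into a product of \<open>sigma\<close> and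
  \<open>tau\<close>, so that a defining relation passed through \<open>class_rel\<close> can be
  read in the group.\<close>

lemmas word_to_group = class_Cons sigma_def[symmetric] tau_def[symmetric] gen_words

lemma words_Cons: "a # x \<in> words S \<longleftrightarrow> [a] \<in> words S \<and> x \<in> words S"
  by (auto simp: words_def)

lemma sigma_tau_commute:
  assumes "i \<in> {1..<n}" "j \<in> {1..<n}" "\<bar>int i - int j\<bar> > 1"
  shows "sigma n i \<otimes>\<^bsub>VB n\<^esub> tau n j = tau n j \<otimes>\<^bsub>VB n\<^esub> sigma n i"
  using class_rel[OF vb_rels.mixed_comm[OF assms]] assms
  by (simp add: word_to_group words_Cons[of _ "[_]"])

lemma tau_tau_commute:
  assumes "i \<in> {1..<n}" "j \<in> {1..<n}" "\<bar>int i - int j\<bar> > 1"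
  shows "tau n i \<otimes>\<^bsub>VB n\<^esub> tau n j = tau n j \<otimes>\<^bsub>VB n\<^esub> tau n i"
  using class_rel[OF vb_rels.tau_comm[OF assms]] assms
  by (simp add: word_to_group words_Cons[of _ "[_]"])

lemma sigma_tau_braid:
  assumes "i \<in> {1..<n}" "i + 1 \<in> {1..<n}"
  shows "sigma n i \<otimes>\<^bsub>VB n\<^esub> (tau n (i + 1) \<otimes>\<^bsub>VB n\<^esub> tau n i) =
    tau n (i + 1) \<otimes>\<^bsub>VB n\<^esub> (tau n i \<otimes>\<^bsub>VB n\<^esub> sigma n (i + 1))"
  using class_rel[OF vb_rels.mixed_braid[OF assms]] assms
  by (simp add: word_to_group words_Cons[of _ "[_]"] words_Cons[of _ "[_, _]"])

lemma tau_tau_braid: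
  assumes "i \<in> {1..<n}" "i + 1 \<in> {1..<n}"
  shows "tau n i \<otimes>\<^bsub>VB n\<^esub> (tau n (i + 1) \<otimes>\<^bsub>VB n\<^esub> tau n i) =
    tau n (i + 1) \<otimes>\<^bsub>VB n\<^esub> (tau n i \<otimes>\<^bsub>VB n\<^esub> tau n (i + 1))"
  using class_rel[OF vb_rels.tau_braid[OF assms]] assms
  by (simp add: word_to_group words_Cons[of _ "[_]"] words_Cons[of _ "[_, _]"])

section \<open>The cycles c_k and the relations they satisfy\<close>

text \<open>This is c_k as an element of \<open>VB n\<close>. The degree \<open>n\<close> is an
  argument because c_k is used in degree m and in degree m+1.\<close>

fun tau_cycle :: "nat \<Rightarrow> nat \<Rightarrow> vbraid" where
  "tau_cycle n 0 = \<one>\<^bsub>VB n\<^esub>"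
| "tau_cycle n (Suc k) = tau n (Suc k) \<otimes>\<^bsub>VB n\<^esub> tau_cycle n k"

lemma tau_cycle_closed: "k < n \<Longrightarrow> tau_cycle n k \<in> carrier (VB n)"
proof (induction k)
  case 0
  then show ?case by (simp add: group.is_monoid[OF group_VB])
next
  case (Suc k)
  then show ?case
    by (simp add: monoid.m_closed[OF group.is_monoid[OF group_VB]] tau_closed)
qed

text \<open>A strand added on the right shifts no index, so only the ambient degree of c_k
  changes.\<close>

lemma iota_tau_cycle:
  assumes "k < m"
  shows "iota 0 1 m (tau_cycle m k) = tau_cycle (m + 1) k"
  using assms
proof (induction k)
  case 0
  show ?case
    using hom_one[OF iota_hom[of 0 1 m] group_VB group_VB] by simp
next
  case (Suc k)
  then show ?case
    using hom_mult[OF iota_hom[of 0 1 m], of "tau m (Suc k)" "tau_cycle m k"]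
      iota_tau[of "Suc k" m 0 1]
    by (simp add: tau_closed tau_cycle_closed)
qed

text \<open>The hypotheses on \<open>s\<close> are stated so as to cover both \<open>s = sigma n\<close> and \<open>s = tau n\<close>.\<close>

lemma commute_tau_cycle:
  assumes closed: "\<And>i. i \<in> {1..<n} \<Longrightarrow> s i \<in> carrier (VB n)"
    and comm: "\<And>i j. \<lbrakk>i \<in> {1..<n}; j \<in> {1..<n}; \<bar>int i - int j\<bar> > 1\<rbrakk>
      \<Longrightarrow> s i \<otimes>\<^bsub>VB n\<^esub> tau n j = tau n j \<otimes>\<^bsub>VB n\<^esub> s i"
    and "j < n" "k + 2 \<le> j"
  shows "s j \<otimes>\<^bsub>VB n\<^esub> tau_cycle n k = tau_cycle n k \<otimes>\<^bsub>VB n\<^esub> s j"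
  using \<open>k + 2 \<le> j\<close>
proof (induction k)
  interpret group "VB n" by (rule group_VB)
  {
    case 0
    then show ?case using closed[of j] \<open>j < n\<close> by simp
  next
    case (Suc k)
    have cl: "s j \<in> carrier (VB n)" "tau n (Suc k) \<in> carrier (VB n)"
        "tau_cycle n k \<in> carrier (VB n)"
      using Suc.prems \<open>j < n\<close> by (auto intro: closed tau_closed tau_cycle_closed)
    have "s j \<otimes>\<^bsub>VB n\<^esub> tau n (Suc k) = tau n (Suc k) \<otimes>\<^bsub>VB n\<^esub> s j"
      using Suc.prems \<open>j < n\<close> by (intro comm) auto
    then have "s j \<otimes>\<^bsub>VB n\<^esub> tau_cycle n (Suc k) =
        tau n (Suc k) \<otimes>\<^bsub>VB n\<^esub> (s j \<otimes>\<^bsub>VB n\<^esub> tau_cycle n k)"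
      using cl by (simp flip: m_assoc)
    then show ?case
      using Suc cl by (simp add: m_assoc)
  }
qed

text \<open>Only the factors with index near \<open>i\<close> matter: \<open>s i\<close> commutes
  with every \<open>tau\<close> of index at least \<open>i + 2\<close>, becomes
  \<open>s (i + 1)\<close> on passing the adjacent pair in \<open>braid\<close>, and then commutes
  with every \<open>tau\<close> of index at most \<open>i - 1\<close>.\<close>

lemma gen_tau_cycle:
  assumes closed: "\<And>i. i \<in> {1..<n} \<Longrightarrow> s i \<in> carrier (VB n)"
    and comm: "\<And>i j. \<lbrakk>i \<in> {1..<n}; j \<in> {1..<n}; \<bar>int i - int j\<bar> > 1\<rbrakk>
      \<Longrightarrow> s i \<otimes>\<^bsub>VB n\<^esub> tau n j = tau n j \<otimes>\<^bsub>VB n\<^esub> s i"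
    and braid: "\<And>i. \<lbrakk>i \<in> {1..<n}; i + 1 \<in> {1..<n}\<rbrakk>
      \<Longrightarrow> s i \<otimes>\<^bsub>VB n\<^esub> (tau n (i + 1) \<otimes>\<^bsub>VB n\<^esub> tau n i) =
        tau n (i + 1) \<otimes>\<^bsub>VB n\<^esub> (tau n i \<otimes>\<^bsub>VB n\<^esub> s (i + 1))"
    and i: "1 \<le> i" "Suc i \<le> k" and "k < n"
  shows "s i \<otimes>\<^bsub>VB n\<^esub> tau_cycle n k = tau_cycle n k \<otimes>\<^bsub>VB n\<^esub> s (Suc i)"
  using i(2) \<open>k < n\<close>
\<comment> \<open>The induction starts at \<open>k = Suc i\<close>, where the pair from
  \<open>braid\<close> heads the cycle; each step prepends a \<open>tau\<close> of index at least
  \<open>i + 2\<close>.\<close>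
proof (induction k rule: dec_induct)
  interpret group "VB n" by (rule group_VB)
  {
    case base
    \<comment> \<open>Behind the pair stands \<open>tau_cycle n h\<close> with
      \<open>h = i - 1\<close>, empty if \<open>i = 1\<close>. Since \<open>h + 2 = Suc i\<close>,
      the gap required by \<open>commute_tau_cycle\<close> is met exactly.\<close>
    from i obtain h where h: "i = Suc h" by (cases i) auto
    have cl: "s i \<in> carrier (VB n)" "s (Suc i) \<in> carrier (VB n)" "tau n i \<in> carrier (VB n)"
        "tau n (Suc i) \<in> carrier (VB n)" "tau_cycle n h \<in> carrier (VB n)"
      using h base by (auto intro: closed tau_closed tau_cycle_closed)
    have "s i \<otimes>\<^bsub>VB n\<^esub> tau_cycle n (Suc i) =
        (s i \<otimes>\<^bsub>VB n\<^esub> (tau n (Suc i) \<otimes>\<^bsub>VB n\<^esub> tau n i)) \<otimes>\<^bsub>VB n\<^esub> tau_cycle n h"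
      using cl h by (simp add: m_assoc)
    also have "\<dots> = tau n (Suc i) \<otimes>\<^bsub>VB n\<^esub> (tau n i \<otimes>\<^bsub>VB n\<^esub> (s (Suc i) \<otimes>\<^bsub>VB n\<^esub> tau_cycle n h))"
      using cl braid[of i] i base by (simp add: m_assoc)
    also have "s (Suc i) \<otimes>\<^bsub>VB n\<^esub> tau_cycle n h = tau_cycle n h \<otimes>\<^bsub>VB n\<^esub> s (Suc i)"
      using closed comm h base by (intro commute_tau_cycle) auto
    finally show ?case
      using cl h by (simp add: m_assoc)
  next
    case (step k)
    have cl: "s i \<in> carrier (VB n)" "s (Suc i) \<in> carrier (VB n)"
        "tau n (Suc k) \<in> carrier (VB n)" "tau_cycle n k \<in> carrier (VB n)"
      using i step by (auto intro: closed tau_closed tau_cycle_closed)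
    have "s i \<otimes>\<^bsub>VB n\<^esub> tau n (Suc k) = tau n (Suc k) \<otimes>\<^bsub>VB n\<^esub> s i"
      using i step by (intro comm) auto
    then have "s i \<otimes>\<^bsub>VB n\<^esub> tau_cycle n (Suc k) =
        tau n (Suc k) \<otimes>\<^bsub>VB n\<^esub> (s i \<otimes>\<^bsub>VB n\<^esub> tau_cycle n k)"
      using cl by (simp flip: m_assoc)
    then show ?case
      using step cl by (simp add: m_assoc)
  }
qed

text \<open>By induction, with the top factor peeled off both cycles: the hypothesis turns the last
  \<open>tau n 1\<close> into the lower top factor, and the braid relation for the two top factors
  raises it by one index.\<close>

lemma tau_cycle_tau_1:
  assumes "Suc k < n"
  shows "tau_cycle n k \<otimes>\<^bsub>VB n\<^esub> tau_cycle n (Suc k) \<otimes>\<^bsub>VB n\<^esub> tau n 1 =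
    tau n (Suc k) \<otimes>\<^bsub>VB n\<^esub> (tau_cycle n k \<otimes>\<^bsub>VB n\<^esub> tau_cycle n (Suc k))"
  using assms
proof (induction k)
  interpret group "VB n" by (rule group_VB)
  {
    case 0
    then show ?case using tau_closed[of 1 n] by simp
  next
    case (Suc k)
    define c d t t' where "c = tau_cycle n k" "d = tau_cycle n (Suc k)"
      "t = tau n (Suc k)" "t' = tau n (Suc (Suc k))"
    note defs = this
    have cl: "c \<in> carrier (VB n)" "d \<in> carrier (VB n)" "t \<in> carrier (VB n)"
        "t' \<in> carrier (VB n)" "tau n 1 \<in> carrier (VB n)"
      unfolding defs using Suc.prems by (intro tau_closed tau_cycle_closed; simp)+
    \<comment> \<open>The first cycle is split, while its copy \<open>d\<close> inside the second
      stays whole; this lets \<open>c\<close> and \<open>d\<close> meet as in the induction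
      hypothesis.\<close>
    have d: "tau_cycle n (Suc k) = t \<otimes>\<^bsub>VB n\<^esub> c" by (simp add: defs)
    have e: "tau_cycle n (Suc (Suc k)) = t' \<otimes>\<^bsub>VB n\<^esub> d" by (simp add: defs)
    \<comment> \<open>This is \<open>commute_tau_cycle\<close> for \<open>s = tau n\<close>: the
      factors of \<open>c\<close> have index at most \<open>k\<close>, two below that of
      \<open>t'\<close>.\<close>
    have comm: "c \<otimes>\<^bsub>VB n\<^esub> t' = t' \<otimes>\<^bsub>VB n\<^esub> c"
      unfolding defs using Suc.prems tau_closed tau_tau_commute
      by (intro commute_tau_cycle[symmetric]) auto
    have braid: "t \<otimes>\<^bsub>VB n\<^esub> (t' \<otimes>\<^bsub>VB n\<^esub> t) = t' \<otimes>\<^bsub>VB n\<^esub> (t \<otimes>\<^bsub>VB n\<^esub> t')"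
      unfolding defs using Suc.prems tau_tau_braid[of "Suc k" n] by simp
    have IH: "c \<otimes>\<^bsub>VB n\<^esub> d \<otimes>\<^bsub>VB n\<^esub> tau n 1 = t \<otimes>\<^bsub>VB n\<^esub> (c \<otimes>\<^bsub>VB n\<^esub> d)"
      unfolding defs using Suc by simp
    have "(t \<otimes>\<^bsub>VB n\<^esub> c) \<otimes>\<^bsub>VB n\<^esub> (t' \<otimes>\<^bsub>VB n\<^esub> d) \<otimes>\<^bsub>VB n\<^esub> tau n 1 =
        t \<otimes>\<^bsub>VB n\<^esub> ((c \<otimes>\<^bsub>VB n\<^esub> t') \<otimes>\<^bsub>VB n\<^esub> d \<otimes>\<^bsub>VB n\<^esub> tau n 1)"
      using cl by (simp add: m_assoc)
    also have "\<dots> = t \<otimes>\<^bsub>VB n\<^esub> (t' \<otimes>\<^bsub>VB n\<^esub> (c \<otimes>\<^bsub>VB n\<^esub> d \<otimes>\<^bsub>VB n\<^esub> tau n 1))"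
      using cl unfolding comm by (simp add: m_assoc)
    also have "\<dots> = (t \<otimes>\<^bsub>VB n\<^esub> (t' \<otimes>\<^bsub>VB n\<^esub> t)) \<otimes>\<^bsub>VB n\<^esub> (c \<otimes>\<^bsub>VB n\<^esub> d)"
      using cl unfolding IH by (simp add: m_assoc)
    also have "\<dots> = t' \<otimes>\<^bsub>VB n\<^esub> (t \<otimes>\<^bsub>VB n\<^esub> ((t' \<otimes>\<^bsub>VB n\<^esub> c) \<otimes>\<^bsub>VB n\<^esub> d))"
      using cl unfolding braid by (simp add: m_assoc)
    also have "\<dots> = t' \<otimes>\<^bsub>VB n\<^esub> ((t \<otimes>\<^bsub>VB n\<^esub> c) \<otimes>\<^bsub>VB n\<^esub> (t' \<otimes>\<^bsub>VB n\<^esub> d))"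
      using cl unfolding comm[symmetric] by (simp add: m_assoc)
    finally show ?case
      unfolding d e by (simp add: defs)
  }
qed

section \<open>Moving the extra strand across an arbitrary braid\<close>

text \<open>Every element is the class of a word, and induction runs over its letters. It reduces a
  statement about two homomorphisms to the generators.\<close>

lemma VB_induct [consumes 1, case_names one sigma tau inv mult]:
  assumes "x \<in> carrier (VB m)"
    and one: "P \<one>\<^bsub>VB m\<^esub>"
    and sigma: "\<And>i. i \<in> {1..<m} \<Longrightarrow> P (sigma m i)"
    and tau: "\<And>i. i \<in> {1..<m} \<Longrightarrow> P (tau m i)"
    and inv: "\<And>x. x \<in> carrier (VB m) \<Longrightarrow> P x \<Longrightarrow> P (inv\<^bsub>VB m\<^esub> x)"
    and mult: "\<And>x y. \<lbrakk>x \<in> carrier (VB m); y \<in> carrier (VB m); P x; P y\<rbrakk> \<Longrightarrow> P (x \<otimes>\<^bsub>VB m\<^esub> y)"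
  shows "P x"
proof -
  have gen: "P (vb_rel m `` {[Gen a]})" if "a \<in> vb_gens m" for a
    using that sigma tau by (cases a) (auto simp: vb_gens_iff sigma_def tau_def)
  have "P (vb_rel m `` {w})" if "w \<in> words (vb_gens m)" for w
    using that
  proof (induction w)
    case Nil
    then show ?case by (simp add: class_Nil one)
  next
    case (Cons a w)
    then have a: "[a] \<in> words (vb_gens m)" and w: "w \<in> words (vb_gens m)"
      using words_Cons by blast+
    have "P (vb_rel m `` {[a]})"
    proof (cases a)
      case (Gen g)
      then show ?thesis using a gen by (auto simp: words_def)
    next
      case (GenInv g)
      then have g: "g \<in> vb_gens m" using a by (auto simp: words_def)
      then have "[Gen g] \<in> words (vb_gens m)" by (auto simp: words_def)
      then have "vb_rel m `` {[Gen g]} \<in> carrier (VB m)" by (auto simp: carrier_VB)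
      with inv gen[OF g] show ?thesis
        unfolding GenInv class_GenInv[OF g] by blast
    qed
    then show ?case
      unfolding class_Cons[OF a w] using a w Cons.IH by (intro mult) (auto simp: carrier_VB)
  qed
  with assms(1) show ?thesis by (auto simp: carrier_VB)
qed

text \<open>The property is preserved by products and inverses, so generators suffice. There the two
  maps give index \<open>i\<close> and index \<open>i + 1\<close>, and \<open>gen_tau_cycle\<close>
  applies with \<open>n = m + 1\<close> and \<open>k = m\<close>, as \<open>i < m\<close>.\<close>

lemma iota_tau_cycle_commute:
  assumes "b \<in> carrier (VB m)"
  shows "iota 0 1 m b \<otimes>\<^bsub>VB (m + 1)\<^esub> tau_cycle (m + 1) m =
    tau_cycle (m + 1) m \<otimes>\<^bsub>VB (m + 1)\<^esub> iota 1 0 m b"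
proof -
  \<comment> \<open>Keeps the degree in the form \<open>m + 1\<close>, in which the facts of the
    interpretations are stated.\<close>
  note One_nat_def [simp del]
  interpret group "VB (m + 1)" by (rule group_VB)
  interpret f: group_hom "VB m" "VB (m + 1)" "iota 0 1 m"
    using iota_hom[of 0 1 m] by (simp add: group_hom_def group_hom_axioms_def group_VB)
  interpret g: group_hom "VB m" "VB (m + 1)" "iota 1 0 m"
    using iota_hom[of 1 0 m] by (simp add: group_hom_def group_hom_axioms_def group_VB)
  let ?c = "tau_cycle (m + 1) m"
  have c: "?c \<in> carrier (VB (m + 1))" by (simp add: tau_cycle_closed)
  from assms show ?thesis
  proof (induction rule: VB_induct)
    case one
    show ?case
      unfolding f.hom_one g.hom_one using c by simp
  next
    case (sigma i)
    then show ?case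
      using gen_tau_cycle[of "m + 1" "sigma (m + 1)" i m, unfolded Suc_eq_plus1]
        iota_sigma[OF sigma, of 0 1] iota_sigma[OF sigma, of 1 0]
      by (simp add: sigma_closed sigma_tau_commute sigma_tau_braid)
  next
    case (tau i)
    then show ?case
      using gen_tau_cycle[of "m + 1" "tau (m + 1)" i m, unfolded Suc_eq_plus1]
        iota_tau[OF tau, of 0 1] iota_tau[OF tau, of 1 0]
      by (simp add: tau_closed tau_tau_commute tau_tau_braid)
  next
    case (inv x)
    let ?f = "iota 0 1 m x" and ?g = "iota 1 0 m x"
    have cl: "?f \<in> carrier (VB (m + 1))" "?g \<in> carrier (VB (m + 1))"
      using inv by auto
    \<comment> \<open>The hypothesis is multiplied by the inverse of \<open>?f\<close> on the left,
      then by that of \<open>?g\<close> on the right.\<close>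
    have "?c = inv\<^bsub>VB (m + 1)\<^esub> ?f \<otimes>\<^bsub>VB (m + 1)\<^esub> (?c \<otimes>\<^bsub>VB (m + 1)\<^esub> ?g)"
      using inv_solve_left c cl inv.IH m_closed by metis
    then have "?c \<otimes>\<^bsub>VB (m + 1)\<^esub> inv\<^bsub>VB (m + 1)\<^esub> ?g = inv\<^bsub>VB (m + 1)\<^esub> ?f \<otimes>\<^bsub>VB (m + 1)\<^esub> ?c"
      using inv_solve_right' c cl m_closed inv_closed m_assoc by metis
    then show ?case
      using inv.hyps by simp
  next
    case (mult x y)
    let ?f = "iota 0 1 m" and ?g = "iota 1 0 m"
    have "?f x \<otimes>\<^bsub>VB (m + 1)\<^esub> ?f y \<otimes>\<^bsub>VB (m + 1)\<^esub> ?c = (?f x \<otimes>\<^bsub>VB (m + 1)\<^esub> ?c) \<otimes>\<^bsub>VB (m + 1)\<^esub> ?g y"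
      using mult.hyps mult.IH(2) c by (simp add: m_assoc)
    also have "\<dots> = ?c \<otimes>\<^bsub>VB (m + 1)\<^esub> (?g x \<otimes>\<^bsub>VB (m + 1)\<^esub> ?g y)"
      unfolding mult.IH using mult.hyps c by (simp add: m_assoc)
    finally show ?case
      using mult.hyps by simp
  qed
qed

section \<open>Assembling the chain of moves\<close>

theorem proposition3p4:
  fixes m :: nat and b :: vbraid
  assumes "m \<ge> 1"
    and "b \<in> carrier (VB m)"
  shows "((m, b), (m + 1, left_virtual_stabilization m b))
           \<in> (VM0 \<union> VM1)\<^sup>* O VM2 O (VM0 \<union> VM1)\<^sup>*"
proof -
  note One_nat_def [simp del]
  let ?G = "VB (m + 1)"
  interpret H: group "VB m" by (rule group_VB)
  interpret group ?G by (rule group_VB)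
  interpret f: group_hom "VB m" ?G "iota 0 1 m"
    using iota_hom[of 0 1 m] by (simp add: group_hom_def group_hom_axioms_def group_VB)
  interpret g: group_hom "VB m" ?G "iota 1 0 m"
    using iota_hom[of 1 0 m] by (simp add: group_hom_def group_hom_axioms_def group_VB)
  \<comment> \<open>Here \<open>k = m - 1\<close>, so \<open>p\<close> and \<open>q\<close> below
    are c_(m-1) in degrees m and m+1, and both are the unit if \<open>m = 1\<close>.\<close>
  obtain k where k: "m = Suc k" using assms(1) by (cases m) auto
  define p where "p = tau_cycle m k"
  define q where "q = tau_cycle (m + 1) k"
  define c where "c = tau_cycle (m + 1) m"
  define x where "x = iota 0 1 m b"
  define y where "y = iota 1 0 m b"
  define s where "s = tau (m + 1) m"
  define t where "t = tau (m + 1) 1"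
  have p: "p \<in> carrier (VB m)" by (simp add: p_def k tau_cycle_closed)
  have cl: "q \<in> carrier ?G" "c \<in> carrier ?G" "x \<in> carrier ?G" "y \<in> carrier ?G"
      "s \<in> carrier ?G" "t \<in> carrier ?G"
    unfolding q_def c_def x_def y_def s_def t_def using assms
    by (intro tau_cycle_closed tau_closed f.hom_closed g.hom_closed; simp add: k)+
  have fp: "iota 0 1 m p = q"
    unfolding p_def q_def by (rule iota_tau_cycle) (simp add: k)
  have xc: "x \<otimes>\<^bsub>?G\<^esub> c = c \<otimes>\<^bsub>?G\<^esub> y"
    unfolding x_def c_def y_def using assms by (intro iota_tau_cycle_commute)
  have qct: "q \<otimes>\<^bsub>?G\<^esub> c \<otimes>\<^bsub>?G\<^esub> t = s \<otimes>\<^bsub>?G\<^esub> (q \<otimes>\<^bsub>?G\<^esub> c)"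
    unfolding q_def c_def t_def s_def k by (rule tau_cycle_tau_1) simp
  define b1 where "b1 = p \<otimes>\<^bsub>VB m\<^esub> b \<otimes>\<^bsub>VB m\<^esub> inv\<^bsub>VB m\<^esub> p"
  have b1: "b1 \<in> carrier (VB m)" using p assms by (simp add: b1_def)
  \<comment> \<open>\<open>VM1\<close> puts the inverse of the conjugator on the left, so the
    conjugator is the inverse of \<open>p\<close>.\<close>
  have "b1 = inv\<^bsub>VB m\<^esub> (inv\<^bsub>VB m\<^esub> p) \<otimes>\<^bsub>VB m\<^esub> b \<otimes>\<^bsub>VB m\<^esub> inv\<^bsub>VB m\<^esub> p"
    using p by (simp add: b1_def)
  then have 1: "((m, b), (m, b1)) \<in> VM1"
    unfolding VM1_def using assms p by blast
  define b2 where "b2 = iota 0 1 m b1 \<otimes>\<^bsub>?G\<^esub> s"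
  have 2: "((m, b1), (m + 1, b2)) \<in> VM2"
    unfolding VM2_def right_stabilization_def b2_def s_def using assms(1) b1 by blast
  have b2: "b2 \<in> carrier ?G" using b1 cl by (simp add: b2_def)
  have b2': "b2 = q \<otimes>\<^bsub>?G\<^esub> x \<otimes>\<^bsub>?G\<^esub> inv\<^bsub>?G\<^esub> q \<otimes>\<^bsub>?G\<^esub> s"
    using p assms by (simp add: b2_def b1_def x_def fp)
  \<comment> \<open>Once \<open>qct\<close> has replaced \<open>s\<close>, the inverse of
    \<open>q\<close> meets \<open>q\<close> at the head of a right-nested product; hence the tail
    after \<open>q\<close> is included.\<close>
  have qq: "inv\<^bsub>?G\<^esub> q \<otimes>\<^bsub>?G\<^esub> (q \<otimes>\<^bsub>?G\<^esub> (c \<otimes>\<^bsub>?G\<^esub> t)) = c \<otimes>\<^bsub>?G\<^esub> t"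
    using cl by (simp flip: m_assoc)
  \<comment> \<open>Conjugation by \<open>q\<close> times \<open>c\<close> is checked without
    computing an inverse: \<open>qct\<close> exchanges \<open>s\<close> for \<open>t\<close>,
    \<open>q\<close> cancels, and \<open>xc\<close> exchanges \<open>x\<close> for
    \<open>y\<close>.\<close>
  have "b2 \<otimes>\<^bsub>?G\<^esub> (q \<otimes>\<^bsub>?G\<^esub> c) = q \<otimes>\<^bsub>?G\<^esub> x \<otimes>\<^bsub>?G\<^esub> inv\<^bsub>?G\<^esub> q \<otimes>\<^bsub>?G\<^esub> (s \<otimes>\<^bsub>?G\<^esub> (q \<otimes>\<^bsub>?G\<^esub> c))"
    using cl by (simp add: b2' m_assoc)
  also have "\<dots> = q \<otimes>\<^bsub>?G\<^esub> (x \<otimes>\<^bsub>?G\<^esub> c) \<otimes>\<^bsub>?G\<^esub> t"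
    unfolding qct[symmetric] using cl qq by (simp add: m_assoc)
  also have "\<dots> = (q \<otimes>\<^bsub>?G\<^esub> c) \<otimes>\<^bsub>?G\<^esub> (y \<otimes>\<^bsub>?G\<^esub> t)"
    unfolding xc using cl by (simp add: m_assoc)
  finally have "y \<otimes>\<^bsub>?G\<^esub> t = inv\<^bsub>?G\<^esub> (q \<otimes>\<^bsub>?G\<^esub> c) \<otimes>\<^bsub>?G\<^esub> (b2 \<otimes>\<^bsub>?G\<^esub> (q \<otimes>\<^bsub>?G\<^esub> c))"
    using cl b2 by (subst inv_solve_left) auto
  then have "left_virtual_stabilization m b = inv\<^bsub>?G\<^esub> (q \<otimes>\<^bsub>?G\<^esub> c) \<otimes>\<^bsub>?G\<^esub> b2 \<otimes>\<^bsub>?G\<^esub> (q \<otimes>\<^bsub>?G\<^esub> c)"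
    using cl b2 by (simp add: left_virtual_stabilization_def y_def t_def m_assoc)
  moreover have "q \<otimes>\<^bsub>?G\<^esub> c \<in> carrier ?G" using cl by simp
  ultimately have 3: "((m + 1, b2), (m + 1, left_virtual_stabilization m b)) \<in> VM1"
    unfolding VM1_def using b2 by fastforce
  show ?thesis
    using 1 2 3 by blast
qed

end
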